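(* Fix Lagrangian marker positions $\mathbf{X}_1,\dots,\mathbf{X}_M\in\Omega$, Lagrangian force densities $\mathbf{F}_1,\dots,\mathbf{F}_M\in\mathbb{R}^3$, and a real number $\Delta\mathbf{s}>0$, and let $\delta_h$ be a $C^1$ regularized delta function. Let $\mathbf{f}$ be a periodic vector grid function on the face-centered grid $\mathbb{F}$ with mean $\mathbf{f}_0=\frac1V\sum_{\mathbf{x}\in\mathbb{F}}\mathbf{f}(\mathbf{x})h^3$. (i) The power identity $$\sum_{\mathbf{x}\in\mathbb{F}}\mathbf{u}(\mathbf{x})\cdot\mathbf{f}(\mathbf{x})\,h^3=\sum_{m=1}^M\mathbf{U}_m\cdot\mathbf{F}_m\,\Delta\mathbf{s}$$ holds for all $\mathbf{u}_0\in\mathbb{R}^3$ and all periodic vector grid functions $\mathbf{a}$ on the edge-centered grid $\mathbb{E}$ with $\mathbf{D}^h\cdot\mathbf{a}=0$, where $\mathbf{u}=\mathbf{u}_0+\mathbf{D}^h\times\mathbf{a}$ and $$\mathbf{U}_m=\mathbf{u}_0+\sum_{\mathbf{x}\in\mathbb{E}}\mathbf{a}(\mathbf{x})\times(\nabla\delta_h)(\mathbf{x}-\mathbf{X}_m)\,h^3,$$ if and only if $$\mathbf{f}_0=\frac1V\sum_{m=1}^M\mathbf{F}_m\,\Delta\mathbf{s}$$ and there exists a periodic scalar grid function $\varphi$ on the node-centered grid $\mathbb{N}$ such that $$(\mathbf{D}^h\times\mathbf{f})(\mathbf{x})=\sum_{m=1}^M(\nabla\delta_h)(\mathbf{x}-\mathbf{X}_m)\times(\mathbf{F}_m\,\Delta\mathbf{s})+(\mathbf{G}^h\varphi)(\mathbf{x})\quad\text{for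 all }\mathbf{x}\in\mathbb{E}.$$ (ii) If $\mathbf{f}$ satisfies the two conditions in (i) and in addition $\mathbf{D}^h\cdot\mathbf{f}=0$, then $\mathbf{f}$ satisfies the vector Poisson equation on $\mathbb{F}$ $$-\mathbf{L}^h\mathbf{f}=\mathbf{D}^h\times\left(\sum_{m=1}^M(\nabla\delta_h)(\,\cdot-\mathbf{X}_m)\times(\mathbf{F}_m\,\Delta\mathbf{s})\right),$$ and this equation together with the mean $\mathbf{f}_0$ determines $\mathbf{f}$ uniquely.
   Context: Let $\Omega=[0,L]^3$ with periodic boundary conditions, $N$ a positive integer, $h=L/N$. All indices $i,j,k$ below are taken modulo $N$, and all grid functions are real-valued and periodic. Staggered grids. Cell-centered grid $\mathbb{C}$: points $((i+\frac12)h,(j+\frac12)h,(k+\frac12)h)$. Node-centered grid $\mathbb{N}$: points $(ih,jh,kh)$. A vector grid function on the face-centered grid $\mathbb{F}$ has its component $\alpha\in\{1,2,3\}$ defined on the cell-centered grid shifted by $-\frac h2\mathbf{e}_\alpha$. A vector grid function on the edge-centered grid $\mathbb{E}$ has its component $\alpha$ defined on the node-centered grid shifted by $+\frac h2\mathbf{e}_\alpha$. Here $\mathbf{e}_1,\mathbf{e}_2,\mathbf{e}_3$ is the standard basis of $\mathbb{R}^3$. Difference operators. $D^h_\alpha\varphi(\mathbf{x})=\frac{1}{h}\left(\varphi(\mathbf{x}+\frac h2\mathbf{e}_\alpha)-\varphi(\mathbf{x}-\frac h2\mathbf{e}_\alpha)\right)$; $\mathbf{G}^h\varphi=(D^h_1\varphi,D^h_2\varphi,D^h_3\varphi)$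 (maps functions on $\mathbb{C}$ to $\mathbb{F}$, and on $\mathbb{N}$ to $\mathbb{E}$); $\mathbf{D}^h\cdot\mathbf{v}=\sum_\alpha D^h_\alpha v_\alpha$ (maps $\mathbb{F}$ to $\mathbb{C}$ and $\mathbb{E}$ to $\mathbb{N}$); $(\mathbf{D}^h\times\mathbf{v})_i=\sum_{j,k}\epsilon_{ijk}D^h_jv_k$ (maps $\mathbb{E}$ to $\mathbb{F}$ and $\mathbb{F}$ to $\mathbb{E}$). The scalar Laplacian is $L^h\varphi(\mathbf{x})=\sum_{\alpha=1}^3\frac{\varphi(\mathbf{x}+h\mathbf{e}_\alpha)-2\varphi(\mathbf{x})+\varphi(\mathbf{x}-h\mathbf{e}_\alpha)}{h^2}$, and $\mathbf{L}^h$ applies $L^h$ to each component of a vector grid function. Sums and identities of vector-valued expressions over $\mathbf{x}\in\mathbb{F}$ or $\mathbf{x}\in\mathbb{E}$ are understood componentwise on the appropriate subgrids: $\sum_{\mathbf{x}\in\mathbb{F}}\mathbf{u}\cdot\mathbf{f}\,h^3$ means $\sum_{i=1}^3\sum_{\mathbf{x}}u_i(\mathbf{x})f_i(\mathbf{x})h^3$ with $\mathbf{x}$ running over the subgrid carrying component $i$; the $i$-th component of $\sum_{\mathbf{x}\in\mathbb{E}}\mathbf{a}(\mathbf{x})\times(\nabla\delta_h)(\mathbf{x}-\mathbf{X}_m)h^3$ is $\sum_{j,k}\epsilon_{ijk}\sum_{\mathbf{x}}a_j(\mathbf{x})(\partial_k\delta_h)(\mathbf{x}-\mathbf{X}_m)h^3$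 with $\mathbf{x}$ running over the subgrid carrying $a_j$; and the function $\mathbf{x}\mapsto\sum_m(\nabla\delta_h)(\mathbf{x}-\mathbf{X}_m)\times(\mathbf{F}_m\Delta\mathbf{s})$ is regarded as a vector grid function on $\mathbb{E}$, its $j$-th component being evaluated on the $j$-th subgrid of $\mathbb{E}$. $V=L^3$ is the volume of the domain. Regularized delta function: $\delta_h(\mathbf{x})=\frac1{h^3}\phi(\frac{x_1}h)\phi(\frac{x_2}h)\phi(\frac{x_3}h)$, where $\phi:\mathbb{R}\to\mathbb{R}$ is a compactly supported kernel; on the periodic domain $\delta_h$ is extended periodically, i.e. replaced by $\sum_{\mathbf{n}\in\mathbb{Z}^3}\delta_h(\cdot+L\mathbf{n})$. *)

theory Defs
  imports "HOL-Analysis.Analysis"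
begin

text \<open>
  Grid functions are modelled as functions on all of \<open>\<real>\<^sup>3\<close>; only their values at points of the grid
  they live on are ever used, and no condition is imposed elsewhere. The components of a vector grid
  function live on different subgrids, hence the type of \<open>vector_fn\<close>, with the component
  index first.
\<close>

type_synonym scalar_fn = "real^3 \<Rightarrow> real"
type_synonym vector_fn = "3 \<Rightarrow> real^3 \<Rightarrow> real"

abbreviation unit_vec :: "3 \<Rightarrow> real^3" where
  "unit_vec \<alpha> \<equiv> axis \<alpha> 1"

abbreviation int_vec :: "int^3 \<Rightarrow> real^3" where
  "int_vec n \<equiv> (\<chi> i. of_int (n $ i))"


section \<open>Staggered grids\<close>

text \<open>A grid is a translate of \<open>h\<int>\<^sup>3\<close>; the offset \<open>s\<close> is given in units of \<open>h\<close>.\<close>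

definition grid_point :: "real \<Rightarrow> real^3 \<Rightarrow> int^3 \<Rightarrow> real^3" where
  "grid_point h s n = h *\<^sub>R (int_vec n + s)"

definition grid :: "real \<Rightarrow> real^3 \<Rightarrow> (real^3) set" where
  "grid h s = range (grid_point h s)"

text \<open>One period of the grid (one representative for each index triple modulo \<open>N\<close>); all sums over
  grid points are sums over this finite set.\<close>

definition grid_period :: "nat \<Rightarrow> real \<Rightarrow> real^3 \<Rightarrow> (real^3) set" where
  "grid_period N h s = grid_point h s ` {n. \<forall>i. 0 \<le> n $ i \<and> n $ i < int N}"

definition cell_offset :: "real^3" where
  "cell_offset = (\<chi> i. 1 / 2)"

definition node_offset :: "real^3" where
  "node_offset = 0"

definition face_offset :: "3 \<Rightarrow> real^3" where
  "face_offset \<alpha> = cell_offset - (1 / 2) *\<^sub>R unit_vec \<alpha>"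

definition edge_offset :: "3 \<Rightarrow> real^3" where
  "edge_offset \<alpha> = node_offset + (1 / 2) *\<^sub>R unit_vec \<alpha>"

definition periodic_on :: "real \<Rightarrow> (real^3) set \<Rightarrow> scalar_fn \<Rightarrow> bool" where
  "periodic_on L S \<psi> \<longleftrightarrow> (\<forall>x\<in>S. \<forall>\<alpha>. \<psi> (x + L *\<^sub>R unit_vec \<alpha>) = \<psi> x)"

definition node_fn :: "real \<Rightarrow> real \<Rightarrow> scalar_fn \<Rightarrow> bool" where
  "node_fn L h \<psi> \<longleftrightarrow> periodic_on L (grid h node_offset) \<psi>"

definition face_fn :: "real \<Rightarrow> real \<Rightarrow> vector_fn \<Rightarrow> bool" where
  "face_fn L h v \<longleftrightarrow> (\<forall>\<alpha>. periodic_on L (grid h (face_offset \<alpha>)) (v \<alpha>))"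

definition edge_fn :: "real \<Rightarrow> real \<Rightarrow> vector_fn \<Rightarrow> bool" where
  "edge_fn L h v \<longleftrightarrow> (\<forall>\<alpha>. periodic_on L (grid h (edge_offset \<alpha>)) (v \<alpha>))"


section \<open>Difference operators\<close>

definition levi_civita :: "3 \<Rightarrow> 3 \<Rightarrow> 3 \<Rightarrow> real" where
  "levi_civita i j k =
     (if (i, j, k) \<in> {(1, 2, 3), (2, 3, 1), (3, 1, 2)} then 1
      else if (i, j, k) \<in> {(3, 2, 1), (2, 1, 3), (1, 3, 2)} then - 1
      else 0)"

lemma cross3_levi_civita:
  "cross3 a b $ i = (\<Sum>j\<in>UNIV. \<Sum>k\<in>UNIV. levi_civita i j k * a $ j * b $ k)"
  using exhaust_3[of i] by (auto simp: levi_civita_def cross3_simps sum_3)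

definition diff_h :: "real \<Rightarrow> 3 \<Rightarrow> scalar_fn \<Rightarrow> scalar_fn" where
  "diff_h h \<alpha> \<psi> x =
     (1 / h) * (\<psi> (x + (h / 2) *\<^sub>R unit_vec \<alpha>) - \<psi> (x - (h / 2) *\<^sub>R unit_vec \<alpha>))"

definition grad_h :: "real \<Rightarrow> scalar_fn \<Rightarrow> vector_fn" where
  "grad_h h \<psi> \<alpha> = diff_h h \<alpha> \<psi>"

definition div_h :: "real \<Rightarrow> vector_fn \<Rightarrow> scalar_fn" where
  "div_h h v x = (\<Sum>\<alpha>\<in>UNIV. diff_h h \<alpha> (v \<alpha>) x)"

definition curl_h :: "real \<Rightarrow> vector_fn \<Rightarrow> vector_fn" where
  "curl_h h v i x = (\<Sum>j\<in>UNIV. \<Sum>k\<in>UNIV. levi_civita i j k * diff_h h j (v k) x)"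

definition laplace_h :: "real \<Rightarrow> scalar_fn \<Rightarrow> scalar_fn" where
  "laplace_h h \<psi> x =
     (\<Sum>\<alpha>\<in>UNIV. (\<psi> (x + h *\<^sub>R unit_vec \<alpha>) - 2 * \<psi> x + \<psi> (x - h *\<^sub>R unit_vec \<alpha>)) / h\<^sup>2)"

definition vec_laplace_h :: "real \<Rightarrow> vector_fn \<Rightarrow> vector_fn" where
  "vec_laplace_h h v \<alpha> = laplace_h h (v \<alpha>)"


section \<open>Regularized delta function\<close>

definition compactly_supported :: "(real \<Rightarrow> real) \<Rightarrow> bool" where
  "compactly_supported \<phi> \<longleftrightarrow> compact (closure {r. \<phi> r \<noteq> 0})"

definition delta_free :: "(real \<Rightarrow> real) \<Rightarrow> real \<Rightarrow> scalar_fn" where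
  "delta_free \<phi> h x = 1 / h ^ 3 * \<phi> (x $ 1 / h) * \<phi> (x $ 2 / h) * \<phi> (x $ 3 / h)"

text \<open>For compactly supported \<open>\<phi>\<close> the sum has only finitely many nonzero terms.\<close>

definition delta_h :: "(real \<Rightarrow> real) \<Rightarrow> real \<Rightarrow> real \<Rightarrow> scalar_fn" where
  "delta_h \<phi> L h x = (\<Sum>\<^sub>\<infinity>n\<in>UNIV. delta_free \<phi> h (x + L *\<^sub>R int_vec n))"

definition C1_fn :: "scalar_fn \<Rightarrow> bool" where
  "C1_fn g \<longleftrightarrow> (\<exists>G. (\<forall>x. GDERIV g x :> G x) \<and> continuous_on UNIV G)"

definition gradient :: "scalar_fn \<Rightarrow> real^3 \<Rightarrow> real^3" where
  "gradient g x = (THE D. GDERIV g x :> D)"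


section \<open>Spreading and interpolation\<close>

definition face_mean :: "real \<Rightarrow> nat \<Rightarrow> real \<Rightarrow> vector_fn \<Rightarrow> real^3" where
  "face_mean L N h f =
     (\<chi> i. 1 / L ^ 3 * (\<Sum>x\<in>grid_period N h (face_offset i). f i x * h ^ 3))"

definition face_inner :: "nat \<Rightarrow> real \<Rightarrow> vector_fn \<Rightarrow> vector_fn \<Rightarrow> real" where
  "face_inner N h u f =
     (\<Sum>i\<in>UNIV. \<Sum>x\<in>grid_period N h (face_offset i). u i x * f i x * h ^ 3)"

definition velocity_field :: "real \<Rightarrow> real^3 \<Rightarrow> vector_fn \<Rightarrow> vector_fn" where
  "velocity_field h u0 a i x = u0 $ i + curl_h h a i x"

definition marker_velocity ::
  "nat \<Rightarrow> real \<Rightarrow> scalar_fn \<Rightarrow> real^3 \<Rightarrow> vector_fn \<Rightarrow> real^3 \<Rightarrow> real^3" where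
  "marker_velocity N h \<delta> u0 a Y = u0 +
     (\<chi> i. \<Sum>j\<in>UNIV. \<Sum>k\<in>UNIV. levi_civita i j k *
        (\<Sum>x\<in>grid_period N h (edge_offset j). a j x * gradient \<delta> (x - Y) $ k * h ^ 3))"

definition spread_curl ::
  "scalar_fn \<Rightarrow> nat \<Rightarrow> (nat \<Rightarrow> real^3) \<Rightarrow> (nat \<Rightarrow> real^3) \<Rightarrow> real \<Rightarrow> vector_fn" where
  "spread_curl \<delta> M X F \<Delta>s j x =
     (\<Sum>m = 1..M. cross3 (gradient \<delta> (x - X m)) (\<Delta>s *\<^sub>R F m)) $ j"

definition power_identity ::
  "nat \<Rightarrow> real \<Rightarrow> scalar_fn \<Rightarrow> nat \<Rightarrow> (nat \<Rightarrow> real^3) \<Rightarrow> (nat \<Rightarrow> real^3) \<Rightarrow> real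
     \<Rightarrow> vector_fn \<Rightarrow> real^3 \<Rightarrow> vector_fn \<Rightarrow> bool" where
  "power_identity N h \<delta> M X F \<Delta>s f u0 a \<longleftrightarrow>
     face_inner N h (velocity_field h u0 a) f =
       (\<Sum>m = 1..M. (marker_velocity N h \<delta> u0 a (X m) \<bullet> F m) * \<Delta>s)"

definition mean_condition ::
  "real \<Rightarrow> nat \<Rightarrow> real \<Rightarrow> nat \<Rightarrow> (nat \<Rightarrow> real^3) \<Rightarrow> real \<Rightarrow> vector_fn \<Rightarrow> bool" where
  "mean_condition L N h M F \<Delta>s f \<longleftrightarrow>
     face_mean L N h f = (1 / L ^ 3) *\<^sub>R (\<Sum>m = 1..M. \<Delta>s *\<^sub>R F m)"

definition curl_condition ::
  "real \<Rightarrow> real \<Rightarrow> scalar_fn \<Rightarrow> nat \<Rightarrow> (nat \<Rightarrow> real^3) \<Rightarrow> (nat \<Rightarrow> real^3) \<Rightarrow> real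
     \<Rightarrow> vector_fn \<Rightarrow> bool" where
  "curl_condition L h \<delta> M X F \<Delta>s f \<longleftrightarrow>
     (\<exists>\<psi>. node_fn L h \<psi> \<and>
        (\<forall>i. \<forall>x\<in>grid h (edge_offset i).
           curl_h h f i x = spread_curl \<delta> M X F \<Delta>s i x + grad_h h \<psi> i x))"

definition vector_poisson ::
  "real \<Rightarrow> scalar_fn \<Rightarrow> nat \<Rightarrow> (nat \<Rightarrow> real^3) \<Rightarrow> (nat \<Rightarrow> real^3) \<Rightarrow> real \<Rightarrow> vector_fn \<Rightarrow> bool" where
  "vector_poisson h \<delta> M X F \<Delta>s f \<longleftrightarrow>
     (\<forall>i. \<forall>x\<in>grid h (face_offset i).
        - vec_laplace_h h f i x = curl_h h (spread_curl \<delta> M X F \<Delta>s) i x)"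

end

theory Submission
  imports Defs
begin

text \<open>
  Everything rests on summation by parts on the periodic staggered grids: \<open>D\<^sub>\<alpha>\<close> is skew-adjoint
  between a grid and its half-step translate (\<open>sum_by_parts\<close>), so the curl from edges to faces is adjoint
  to the curl from faces to edges (\<open>curl_adjoint\<close>), and the gradient from nodes to edges is minus the
  adjoint of the divergence (\<open>grad_div_adjoint\<close>).

  Let \<open>E\<close> be the edge field \<open>spread_curl\<close>. Moving the curl from \<open>a\<close> to \<open>f\<close>, and cycling the triple
  products \<open>(a \<times> \<nabla>\<delta>) \<bullet> F = a \<bullet> (\<nabla>\<delta> \<times> F)\<close> on the marker side, turns the power identity into
  \<open>u\<^sub>0 \<bullet> (V f\<^sub>0 - \<Sum>\<^sub>m F\<^sub>m \<Delta>s) + \<langle>a, D \<times> f - E\<rangle> = 0\<close>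
  (\<open>power_identity_iff\<close>). The choice \<open>a = 0\<close> isolates the mean condition; what remains is that
  \<open>D \<times> f - E\<close> is orthogonal to all divergence-free edge fields. Gradients have this property because
  divergence and gradient are adjoint up to sign. Conversely (\<open>hodge_gradient\<close>), subtract from such a
  field \<open>w\<close> its orthogonal projection \<open>G \<psi>\<close> onto the finite-dimensional space of gradients. The
  residual \<open>r = w - G \<psi>\<close> is orthogonal to gradients, hence divergence-free, hence orthogonal to \<open>w\<close>
  by assumption; so \<open>\<langle>r, r\<rangle> = \<langle>r, w\<rangle> - \<langle>r, G \<psi>\<rangle> = 0\<close>.

  For part (ii), taking the curl of \<open>D \<times> f = E + G \<psi>\<close> removes \<open>\<psi>\<close>, and the identity
  curl curl = grad div - Laplacian (\<open>curl_h_curl_h\<close>) gives the Poisson equation when \<open>f\<close> is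
  divergence-free. The difference of two solutions with equal means is a periodic harmonic function with
  mean zero in each component; summing it by parts against its Laplacian shows that all its
  differences vanish, so it is constant and therefore zero (\<open>harmonic_mean_zero\<close>).
\<close>

section \<open>Periodic functions on a translate of the lattice\<close>

lemma int_vec_add: "int_vec (n + m) = int_vec n + int_vec m"
  by (simp add: vec_eq_iff)

lemma of_int_vec_component: "(of_int k :: int^3) $ i = k"
  by (cases k) (simp_all add: of_nat_index)

lemma int_vec_axis: "int_vec (axis \<alpha> 1) = unit_vec \<alpha>"
  by (simp add: vec_eq_iff axis_def)

lemma int_vec_minus_axis: "int_vec (- axis \<alpha> 1) = - unit_vec \<alpha>"
  by (simp add: vec_eq_iff axis_def)

lemma grid_point_add: "grid_point h s (n + m) = grid_point h s n + h *\<^sub>R int_vec m"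
  by (simp only: grid_point_def int_vec_add scaleR_add_right add_ac)

lemma grid_point_offset: "grid_point h (s + int_vec m) n = grid_point h s (n + m)"
  by (simp only: grid_point_def int_vec_add scaleR_add_right add_ac)

lemma grid_pointI [simp]: "grid_point h s n \<in> grid h s"
  by (simp add: grid_def)

lemma grid_offset_int: "grid h (s + int_vec m) = grid h s"
proof -
  have "range (\<lambda>n. grid_point h s (n + m)) = grid_point h s ` range (\<lambda>n. n + m)"
    by (simp only: image_image)
  also have "range (\<lambda>n. n + m) = UNIV"
    by (rule surjI[of _ "\<lambda>n. n - m"]) simp
  finally show ?thesis
    unfolding grid_def grid_point_offset .
qed

lemma grid_offset_unit: "grid h (s + unit_vec \<alpha>) = grid h s"
  using grid_offset_int[of h s "axis \<alpha> 1"] by (simp only: int_vec_axis)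

text \<open>Both half steps reach the same grid, because their end points differ by the lattice vector
  \<open>h e\<^sub>\<alpha>\<close>. A difference quotient centred at a point of one grid therefore uses values on a single other
  grid.\<close>

lemma grid_half_step:
  assumes "x \<in> grid h s"
  shows "x + (h / 2) *\<^sub>R unit_vec \<alpha> \<in> grid h (s + (1 / 2) *\<^sub>R unit_vec \<alpha>)"
    and "x - (h / 2) *\<^sub>R unit_vec \<alpha> \<in> grid h (s + (1 / 2) *\<^sub>R unit_vec \<alpha>)"
proof -
  obtain n where n: "x = grid_point h s n"
    using assms by (auto simp: grid_def)
  have "x + (h / 2) *\<^sub>R unit_vec \<alpha> = grid_point h (s + (1 / 2) *\<^sub>R unit_vec \<alpha>) n"
    by (simp add: n grid_point_def algebra_simps)
  then show "x + (h / 2) *\<^sub>R unit_vec \<alpha> \<in> grid h (s + (1 / 2) *\<^sub>R unit_vec \<alpha>)"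
    by simp
  have "x - (h / 2) *\<^sub>R unit_vec \<alpha>
      = grid_point h (s + (1 / 2) *\<^sub>R unit_vec \<alpha>) n + h *\<^sub>R int_vec (- axis \<alpha> 1)"
    unfolding int_vec_minus_axis
    by (simp add: n grid_point_def algebra_simps flip: scaleR_add_left)
  then show "x - (h / 2) *\<^sub>R unit_vec \<alpha> \<in> grid h (s + (1 / 2) *\<^sub>R unit_vec \<alpha>)"
    by (metis grid_point_add grid_pointI)
qed

lemma periodic_on_const: "periodic_on L S (\<lambda>_. c)"
  by (simp add: periodic_on_def)

lemma periodic_on_diff:
  "periodic_on L S u \<Longrightarrow> periodic_on L S v \<Longrightarrow> periodic_on L S (\<lambda>x. u x - v x)"
  by (simp add: periodic_on_def)

lemma periodic_on_mult:
  "periodic_on L S u \<Longrightarrow> periodic_on L S v \<Longrightarrow> periodic_on L S (\<lambda>x. u x * v x)"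
  by (simp add: periodic_on_def)

lemma periodic_on_sum:
  "(\<And>b. b \<in> B \<Longrightarrow> periodic_on L S (u b)) \<Longrightarrow> periodic_on L S (\<lambda>x. \<Sum>b\<in>B. u b x)"
  by (simp add: periodic_on_def)

lemma periodic_on_half_step:
  assumes "periodic_on L (grid h (s + (1 / 2) *\<^sub>R unit_vec \<alpha>)) \<psi>"
  shows "periodic_on L (grid h s) (\<lambda>x. \<psi> (x + (h / 2) *\<^sub>R unit_vec \<alpha>))"
    and "periodic_on L (grid h s) (\<lambda>x. \<psi> (x - (h / 2) *\<^sub>R unit_vec \<alpha>))"
proof -
  have "\<psi> (x + L *\<^sub>R unit_vec \<beta> + (h / 2) *\<^sub>R unit_vec \<alpha>) = \<psi> (x + (h / 2) *\<^sub>R unit_vec \<alpha>)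
      \<and> \<psi> (x + L *\<^sub>R unit_vec \<beta> - (h / 2) *\<^sub>R unit_vec \<alpha>) = \<psi> (x - (h / 2) *\<^sub>R unit_vec \<alpha>)"
    if "x \<in> grid h s" for x \<beta>
  proof -
    have "x + L *\<^sub>R unit_vec \<beta> + (h / 2) *\<^sub>R unit_vec \<alpha> = (x + (h / 2) *\<^sub>R unit_vec \<alpha>) + L *\<^sub>R unit_vec \<beta>"
      "x + L *\<^sub>R unit_vec \<beta> - (h / 2) *\<^sub>R unit_vec \<alpha> = (x - (h / 2) *\<^sub>R unit_vec \<alpha>) + L *\<^sub>R unit_vec \<beta>"
      by simp_all
    then show ?thesis
      using assms grid_half_step[OF that, of \<alpha>] unfolding periodic_on_def by metis
  qed
  then show "periodic_on L (grid h s) (\<lambda>x. \<psi> (x + (h / 2) *\<^sub>R unit_vec \<alpha>))"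
    "periodic_on L (grid h s) (\<lambda>x. \<psi> (x - (h / 2) *\<^sub>R unit_vec \<alpha>))"
    by (simp_all add: periodic_on_def)
qed

lemma periodic_on_diff_h:
  assumes "periodic_on L (grid h (s + (1 / 2) *\<^sub>R unit_vec \<alpha>)) \<psi>"
  shows "periodic_on L (grid h s) (diff_h h \<alpha> \<psi>)"
proof -
  have "diff_h h \<alpha> \<psi> = (\<lambda>x. (1 / h) * (\<psi> (x + (h / 2) *\<^sub>R unit_vec \<alpha>) - \<psi> (x - (h / 2) *\<^sub>R unit_vec \<alpha>)))"
    by (simp add: fun_eq_iff diff_h_def)
  then show ?thesis
    by (simp only:) (intro periodic_on_mult periodic_on_const periodic_on_diff periodic_on_half_step assms)
qed

text \<open>Stated for an arbitrary period \<open>K h\<close>: the case \<open>K = 1\<close> says that a function invariant under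
  all single steps is constant on its grid.\<close>

lemma periodic_on_int_translate:
  assumes g: "periodic_on (real K * h) (grid h s) g"
  shows "g (grid_point h s (n + of_nat K * m)) = g (grid_point h s n)"
proof -
  \<comment> \<open>Multiples of \<open>K\<close> in one direction: first forward by induction, then backward by starting at the
    other end. Three such moves, one for each direction, give \<open>K m\<close>.\<close>
  have nat_steps: "g (grid_point h s (n + of_nat (K * k) * axis \<alpha> 1)) = g (grid_point h s n)" for n k \<alpha>
  proof (induction k)
    case (Suc k)
    have "grid_point h s (n + of_nat (K * Suc k) * axis \<alpha> 1)
        = grid_point h s (n + of_nat (K * k) * axis \<alpha> 1) + (real K * h) *\<^sub>R unit_vec \<alpha>"
      by (simp add: grid_point_def vec_eq_iff algebra_simps axis_def of_nat_index)
    then show ?case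
      using g Suc.IH unfolding periodic_on_def by (metis grid_pointI)
  qed simp
  have steps: "g (grid_point h s (n + of_nat K * (of_int k * axis \<alpha> 1))) = g (grid_point h s n)" for n k \<alpha>
  proof (cases "k \<ge> 0")
    case True
    then have "of_nat K * (of_int k * axis \<alpha> 1) = (of_nat (K * nat k) * axis \<alpha> 1 :: int^3)"
      by (simp add: vec_eq_iff)
    then show ?thesis
      using nat_steps[of n "nat k" \<alpha>] by simp
  next
    case False
    let ?n' = "n + of_nat K * (of_int k * axis \<alpha> 1)"
    have "?n' + of_nat (K * nat (- k)) * axis \<alpha> 1 = n"
      using False by (simp add: vec_eq_iff of_nat_index of_int_vec_component algebra_simps)
    then show ?thesis
      using nat_steps[of ?n' "nat (- k)" \<alpha>] by (simp only:)
  qed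
  have "n + of_nat K * m = n + of_nat K * (of_int (m $ 1) * axis 1 1)
      + of_nat K * (of_int (m $ 2) * axis 2 1) + of_nat K * (of_int (m $ 3) * axis 3 1)"
    by (simp add: vec_eq_iff forall_3 axis_def of_nat_index of_int_vec_component)
  then show ?thesis
    by (simp only: steps)
qed

section \<open>Sums over one period\<close>

definition period_sum :: "nat \<Rightarrow> real \<Rightarrow> real^3 \<Rightarrow> scalar_fn \<Rightarrow> real" where
  "period_sum N h s g = (\<Sum>x\<in>grid_period N h s. g x)"

abbreviation index_box :: "nat \<Rightarrow> (int^3) set" where
  "index_box N \<equiv> {n. \<forall>i. 0 \<le> n $ i \<and> n $ i < int N}"

abbreviation wrap :: "nat \<Rightarrow> int^3 \<Rightarrow> int^3" where
  "wrap N n \<equiv> (\<chi> i. n $ i mod int N)"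

lemma finite_index_box: "finite (index_box N)"
proof -
  have "index_box N \<subseteq> (\<lambda>f. \<chi> i. f i) ` (PiE UNIV (\<lambda>_. {0..<int N}))"
  proof
    fix n assume "n \<in> index_box N"
    then have "n = (\<chi> i. n $ i)" "(\<lambda>i. n $ i) \<in> PiE UNIV (\<lambda>_. {0..<int N})"
      by auto
    then show "n \<in> (\<lambda>f. \<chi> i. f i) ` (PiE UNIV (\<lambda>_. {0..<int N}))"
      by blast
  qed
  then show ?thesis
    by (rule finite_subset) (intro finite_imageI finite_PiE; simp)
qed

lemma finite_grid_period [simp]: "finite (grid_period N h s)"
  by (simp add: grid_period_def finite_index_box)

lemma grid_period_subset: "grid_period N h s \<subseteq> grid h s"
  by (auto simp: grid_period_def grid_def)

locale periodic_grid =
  fixes L h :: real and N :: nat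
  assumes h_pos: "h > 0" and N_pos: "N > 0" and L_eq: "L = real N * h"
begin

lemma grid_point_inj: "grid_point h s n = grid_point h s m \<longleftrightarrow> n = m"
  using h_pos by (auto simp: grid_point_def vec_eq_iff)

lemma period_sum_index:
  "period_sum N h s g = (\<Sum>n\<in>index_box N. g (grid_point h s n))"
  unfolding period_sum_def grid_period_def
  by (subst sum.reindex) (auto simp: inj_on_def grid_point_inj)

lemma wrap_in_box: "wrap N n \<in> index_box N"
  using N_pos by simp

lemma periodic_wrap:
  assumes "periodic_on L (grid h s) g"
  shows "g (grid_point h s (wrap N n)) = g (grid_point h s n)"
proof -
  have "n = wrap N n + of_nat N * (\<chi> i. n $ i div int N)"
    by (simp add: vec_eq_iff of_nat_index)
  then show ?thesis
    using periodic_on_int_translate[of N h s g "wrap N n" "\<chi> i. n $ i div int N"] assms L_eq by simp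
qed

lemma periodic_zero_on_period:
  assumes "periodic_on L (grid h s) g" "\<And>x. x \<in> grid_period N h s \<Longrightarrow> g x = 0" "x \<in> grid h s"
  shows "g x = 0"
proof -
  obtain n where n: "x = grid_point h s n"
    using assms(3) by (auto simp: grid_def)
  have "grid_point h s (wrap N n) \<in> grid_period N h s"
    using wrap_in_box[of n] by (auto simp: grid_period_def)
  then show ?thesis
    using assms(2) periodic_wrap[OF assms(1), of n] n by metis
qed

text \<open>Translation by \<open>m\<close> followed by reduction modulo \<open>N\<close> permutes the index box.\<close>

lemma period_sum_offset:
  assumes g: "periodic_on L (grid h s) g"
  shows "period_sum N h (s + int_vec m) g = period_sum N h s g"
proof -
  have "period_sum N h (s + int_vec m) g = (\<Sum>n\<in>index_box N. g (grid_point h s (wrap N (n + m))))"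
    by (simp only: period_sum_index grid_point_offset periodic_wrap[OF g])
  also have "\<dots> = (\<Sum>n\<in>index_box N. g (grid_point h s n))"
    by (rule sum.reindex_bij_witness[where i = "\<lambda>n. wrap N (n - m)" and j = "\<lambda>n. wrap N (n + m)"])
       (use N_pos in \<open>auto simp: vec_eq_iff mod_simps\<close>)
  finally show ?thesis
    by (simp add: period_sum_index)
qed

lemma period_sum_offset_unit:
  "periodic_on L (grid h s) g \<Longrightarrow> period_sum N h (s + unit_vec \<alpha>) g = period_sum N h s g"
  using period_sum_offset[of s g "axis \<alpha> 1"] by (simp only: int_vec_axis)

lemma period_sum_translate:
  "period_sum N h s (\<lambda>x. g (x + h *\<^sub>R t)) = period_sum N h (s + t) g"
  by (simp add: period_sum_index grid_point_def algebra_simps)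

text \<open>The sum over \<open>s\<close> of the forward half becomes a sum over \<open>s + e\<^sub>\<alpha>/2\<close>, that of the backward half one
  over \<open>s - e\<^sub>\<alpha>/2\<close>; the latter is the same grid one full step back, and periodicity makes that step
  harmless. Hence no boundary terms appear.\<close>

lemma sum_by_parts:
  assumes u: "periodic_on L (grid h s) u"
    and v: "periodic_on L (grid h (s + (1 / 2) *\<^sub>R unit_vec \<alpha>)) v"
  shows "period_sum N h s (\<lambda>x. u x * diff_h h \<alpha> v x)
       = - period_sum N h (s + (1 / 2) *\<^sub>R unit_vec \<alpha>) (\<lambda>x. diff_h h \<alpha> u x * v x)"
proof -
  let ?e = "(1 / 2) *\<^sub>R unit_vec \<alpha>" and ?k = "(h / 2) *\<^sub>R unit_vec \<alpha>"
  have k: "?k = h *\<^sub>R ?e" by simp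
  have e: "s + ?e + ?e = s + unit_vec \<alpha>"
    by (simp add: flip: scaleR_add_left)
  have u_up: "periodic_on L (grid h (s + ?e)) (\<lambda>y. u (y + ?k))"
    \<comment> \<open>two half steps return to the grid of \<open>u\<close>\<close>
    by (rule periodic_on_half_step) (simp only: e grid_offset_unit u)
  have "period_sum N h s (\<lambda>x. u x * v (x + ?k))
      = period_sum N h s (\<lambda>x. (\<lambda>y. u (y - ?k) * v y) (x + h *\<^sub>R ?e))"
    by simp
  also have "\<dots> = period_sum N h (s + ?e) (\<lambda>y. u (y - ?k) * v y)"
    by (rule period_sum_translate)
  finally have up: "period_sum N h s (\<lambda>x. u x * v (x + ?k)) = \<dots>" .
  have "period_sum N h s (\<lambda>x. u x * v (x - ?k))
      = period_sum N h s (\<lambda>x. (\<lambda>y. u (y + ?k) * v y) (x + h *\<^sub>R (- ?e)))"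
    by simp
  also have "\<dots> = period_sum N h (s + - ?e) (\<lambda>y. u (y + ?k) * v y)"
    by (rule period_sum_translate)
  also have "s + - ?e = s + ?e + int_vec (- axis \<alpha> 1)"
    unfolding int_vec_minus_axis by (simp add: algebra_simps flip: scaleR_add_left)
  also have "period_sum N h \<dots> (\<lambda>y. u (y + ?k) * v y) = period_sum N h (s + ?e) (\<lambda>y. u (y + ?k) * v y)"
    by (intro period_sum_offset periodic_on_mult u_up v)
  finally have down: "period_sum N h s (\<lambda>x. u x * v (x - ?k)) = \<dots>" .
  have "period_sum N h s (\<lambda>x. u x * diff_h h \<alpha> v x)
     = (1 / h) * (period_sum N h s (\<lambda>x. u x * v (x + ?k)) - period_sum N h s (\<lambda>x. u x * v (x - ?k)))"
    by (simp add: period_sum_def diff_h_def sum_distrib_left sum_subtractf[symmetric] algebra_simps)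
  also have "\<dots> = - period_sum N h (s + ?e) (\<lambda>x. diff_h h \<alpha> u x * v x)"
    unfolding up down
    by (simp add: period_sum_def diff_h_def sum_distrib_left sum_subtractf[symmetric] sum_negf[symmetric] algebra_simps)
  finally show ?thesis .
qed

end

section \<open>Orthogonal projection onto finitely many functions\<close>

text \<open>Gram--Schmidt.  The new function \<open>v b\<close> is first projected onto the old ones; if its residual
  vanishes on \<open>S\<close> nothing has to be added, otherwise the multiple of that residual contained in
  \<open>w\<close> is removed as well.\<close>

lemma finite_projection:
  fixes v :: "'b \<Rightarrow> 'p \<Rightarrow> real"
  assumes "finite B" "finite S"
  shows "\<exists>c. \<forall>b\<in>B. (\<Sum>p\<in>S. (w p - (\<Sum>b'\<in>B. c b' * v b' p)) * v b p) = 0"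
  using assms(1)
proof (induction B arbitrary: w)
  case empty
  then show ?case by simp
next
  case (insert b0 B)
  obtain c where c: "\<And>b. b \<in> B \<Longrightarrow> (\<Sum>p\<in>S. (w p - (\<Sum>b'\<in>B. c b' * v b' p)) * v b p) = 0"
    using insert.IH[of w] by blast
  obtain d where d: "\<And>b. b \<in> B \<Longrightarrow> (\<Sum>p\<in>S. (v b0 p - (\<Sum>b'\<in>B. d b' * v b' p)) * v b p) = 0"
    using insert.IH[of "v b0"] by blast
  define r where "r p = w p - (\<Sum>b'\<in>B. c b' * v b' p)" for p
  define q where "q p = v b0 p - (\<Sum>b'\<in>B. d b' * v b' p)" for p
  define t where "t = (\<Sum>p\<in>S. r p * q p) / (\<Sum>p\<in>S. q p * q p)"
  define e where "e = (\<lambda>b. if b = b0 then t else c b - t * d b)"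
  have "w p - (\<Sum>b'\<in>insert b0 B. e b' * v b' p) = r p - t * q p" for p
  proof -
    have "(\<Sum>b'\<in>insert b0 B. e b' * v b' p) = t * v b0 p + (\<Sum>b'\<in>B. e b' * v b' p)"
      using insert.hyps by (simp add: e_def)
    also have "(\<Sum>b'\<in>B. e b' * v b' p) = (\<Sum>b'\<in>B. c b' * v b' p - t * (d b' * v b' p))"
      using insert.hyps by (intro sum.cong) (auto simp: e_def algebra_simps)
    finally show ?thesis
      by (simp add: r_def q_def sum_subtractf sum_distrib_left algebra_simps)
  qed
  moreover have old: "(\<Sum>p\<in>S. (r p - t * q p) * v b p) = 0" if "b \<in> B" for b
  proof -
    have "(\<Sum>p\<in>S. (r p - t * q p) * v b p) = (\<Sum>p\<in>S. r p * v b p) - t * (\<Sum>p\<in>S. q p * v b p)"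
      by (simp add: sum_subtractf sum_distrib_left algebra_simps)
    then show ?thesis
      using c[OF that] d[OF that] by (simp add: r_def q_def)
  qed
  moreover have "(\<Sum>p\<in>S. (r p - t * q p) * v b0 p) = 0"
  proof -
    have "(\<Sum>p\<in>S. q p * q p) = 0 \<Longrightarrow> \<forall>p\<in>S. q p = 0"
      using assms(2) by (subst (asm) sum_nonneg_eq_0_iff) auto
    then have q: "(\<Sum>p\<in>S. r p * q p) - t * (\<Sum>p\<in>S. q p * q p) = 0"
      by (cases "(\<Sum>p\<in>S. q p * q p) = 0") (auto simp: t_def)
    have "(\<Sum>p\<in>S. (r p - t * q p) * v b0 p)
        = (\<Sum>p\<in>S. (r p - t * q p) * q p) + (\<Sum>p\<in>S. \<Sum>b\<in>B. d b * ((r p - t * q p) * v b p))"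
      unfolding sum.distrib[symmetric]
    proof (intro sum.cong refl)
      fix p
      have "v b0 p = q p + (\<Sum>b\<in>B. d b * v b p)" by (simp add: q_def)
      then show "(r p - t * q p) * v b0 p
          = (r p - t * q p) * q p + (\<Sum>b\<in>B. d b * ((r p - t * q p) * v b p))"
        by (simp add: distrib_left sum_distrib_left mult_ac)
    qed
    also have "(\<Sum>p\<in>S. \<Sum>b\<in>B. d b * ((r p - t * q p) * v b p))
        = (\<Sum>b\<in>B. d b * (\<Sum>p\<in>S. (r p - t * q p) * v b p))"
      by (subst sum.swap) (simp add: sum_distrib_left)
    also have "\<dots> = 0"
      using old by (simp add: sum.neutral)
    also have "(\<Sum>p\<in>S. (r p - t * q p) * q p) = (\<Sum>p\<in>S. r p * q p) - t * (\<Sum>p\<in>S. q p * q p)"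
      by (simp add: sum_subtractf sum_distrib_left algebra_simps)
    finally show ?thesis using q by simp
  qed
  ultimately show ?case
    by (intro exI[of _ e]) auto
qed


section \<open>The staggered difference operators\<close>

lemma diff_h_add: "diff_h h \<alpha> (\<lambda>x. u x + v x) x = diff_h h \<alpha> u x + diff_h h \<alpha> v x"
  by (simp add: diff_h_def algebra_simps)

lemma diff_h_minus: "diff_h h \<alpha> (\<lambda>x. u x - v x) x = diff_h h \<alpha> u x - diff_h h \<alpha> v x"
  by (simp add: diff_h_def algebra_simps)

lemma diff_h_sum: "diff_h h \<alpha> (\<lambda>x. \<Sum>b\<in>B. c b * u b x) x = (\<Sum>b\<in>B. c b * diff_h h \<alpha> (u b) x)"
  by (simp add: diff_h_def sum_distrib_left sum_subtractf[symmetric] algebra_simps)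

lemma diff_h_cong:
  assumes "\<And>y. y \<in> grid h (s + (1 / 2) *\<^sub>R unit_vec \<alpha>) \<Longrightarrow> u y = v y" "x \<in> grid h s"
  shows "diff_h h \<alpha> u x = diff_h h \<alpha> v x"
  using grid_half_step[OF assms(2), of \<alpha>] assms(1) by (simp add: diff_h_def)

lemma diff_h_commute: "diff_h h \<alpha> (diff_h h \<beta> \<psi>) x = diff_h h \<beta> (diff_h h \<alpha> \<psi>) x"
  by (simp add: diff_h_def algebra_simps)

lemma laplace_h_diff_h:
  assumes "h \<noteq> 0"
  shows "laplace_h h \<psi> x = (\<Sum>\<alpha>\<in>UNIV. diff_h h \<alpha> (diff_h h \<alpha> \<psi>) x)"
  unfolding laplace_h_def
proof (intro sum.cong refl)
  fix \<alpha>
  let ?k = "(h / 2) *\<^sub>R unit_vec \<alpha>"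
  have "x + ?k + ?k = x + h *\<^sub>R unit_vec \<alpha>" "x - ?k - ?k = x - h *\<^sub>R unit_vec \<alpha>"
    by (simp_all add: diff_diff_eq add.assoc flip: scaleR_add_left)
  then show "(\<psi> (x + h *\<^sub>R unit_vec \<alpha>) - 2 * \<psi> x + \<psi> (x - h *\<^sub>R unit_vec \<alpha>)) / h\<^sup>2
      = diff_h h \<alpha> (diff_h h \<alpha> \<psi>) x"
    using assms by (simp add: diff_h_def field_simps power2_eq_square)
qed

lemma curl_h_components:
  "curl_h h v 1 = (\<lambda>x. diff_h h 2 (v 3) x - diff_h h 3 (v 2) x)"
  "curl_h h v 2 = (\<lambda>x. diff_h h 3 (v 1) x - diff_h h 1 (v 3) x)"
  "curl_h h v 3 = (\<lambda>x. diff_h h 1 (v 2) x - diff_h h 2 (v 1) x)"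
  by (simp_all add: fun_eq_iff curl_h_def sum_3 levi_civita_def)

lemma curl_h_add: "curl_h h (\<lambda>k x. u k x + v k x) i x = curl_h h u i x + curl_h h v i x"
  using exhaust_3[of i] by (auto simp: curl_h_components diff_h_add)

lemma curl_h_grad_h: "curl_h h (grad_h h \<psi>) i x = 0"
  using exhaust_3[of i] by (auto simp: curl_h_components grad_h_def intro: diff_h_commute)

text \<open>Like \<open>curl_h_grad_h\<close>, a pointwise identity on the whole of space that comes from the \<open>D\<^sub>\<alpha>\<close>
  commuting, exactly as in the continuous case.\<close>

lemma curl_h_curl_h:
  assumes "h \<noteq> 0"
  shows "curl_h h (curl_h h v) i x = grad_h h (div_h h v) i x - vec_laplace_h h v i x"
proof -
  have "div_h h v = (\<lambda>x. diff_h h 1 (v 1) x + diff_h h 2 (v 2) x + diff_h h 3 (v 3) x)"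
    by (simp add: fun_eq_iff div_h_def sum_3)
  moreover have "diff_h h 2 (diff_h h 1 u) x = diff_h h 1 (diff_h h 2 u) x"
    "diff_h h 3 (diff_h h 1 u) x = diff_h h 1 (diff_h h 3 u) x"
    "diff_h h 3 (diff_h h 2 u) x = diff_h h 2 (diff_h h 3 u) x" for u
    by (rule diff_h_commute)+
  ultimately show ?thesis
    using exhaust_3[of i]
    by (auto simp: curl_h_components grad_h_def vec_laplace_h_def laplace_h_diff_h[OF assms]
        sum_3 diff_h_add diff_h_minus)
qed

text \<open>The bookkeeping of the staggering: which grid a difference operator leads to. Offsets are compared
  exactly, so a full step may remain; it changes one period of a grid but not the grid itself.\<close>

lemma staggered_half_steps:
  "node_offset + (1 / 2) *\<^sub>R unit_vec \<alpha> = edge_offset \<alpha>"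
  "edge_offset \<alpha> + (1 / 2) *\<^sub>R unit_vec \<alpha> = node_offset + unit_vec \<alpha>"
  "cell_offset + (1 / 2) *\<^sub>R unit_vec \<alpha> = face_offset \<alpha> + unit_vec \<alpha>"
  by (simp_all add: edge_offset_def face_offset_def add.assoc algebra_simps flip: scaleR_add_left)

lemma staggered_curl_steps:
  assumes "levi_civita i j k \<noteq> 0"
  shows "edge_offset i + (1 / 2) *\<^sub>R unit_vec j = face_offset k"
    and "face_offset i + (1 / 2) *\<^sub>R unit_vec j = edge_offset k + unit_vec j"
proof -
  have "(i, j, k) \<in> {(1, 2, 3), (2, 3, 1), (3, 1, 2), (3, 2, 1), (2, 1, 3), (1, 3, 2)}"
    using assms by (auto simp: levi_civita_def split: if_splits)
  then show "edge_offset i + (1 / 2) *\<^sub>R unit_vec j = face_offset k"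
    "face_offset i + (1 / 2) *\<^sub>R unit_vec j = edge_offset k + unit_vec j"
    by (auto simp: edge_offset_def face_offset_def cell_offset_def node_offset_def vec_eq_iff
        forall_3 axis_def)
qed

lemma levi_civita_swap: "levi_civita k j i = - levi_civita i j k"
  using exhaust_3[of i] exhaust_3[of j] exhaust_3[of k] by (auto simp: levi_civita_def)

text \<open>This allows an equation known only on the edge grid to be put under a curl.\<close>

lemma curl_h_cong:
  assumes "\<And>k y. y \<in> grid h (edge_offset k) \<Longrightarrow> v k y = w k y" "x \<in> grid h (face_offset i)"
  shows "curl_h h v i x = curl_h h w i x"
  unfolding curl_h_def
proof (intro sum.cong refl)
  fix j k
  show "levi_civita i j k * diff_h h j (v k) x = levi_civita i j k * diff_h h j (w k) x"
  proof (cases "levi_civita i j k = 0")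
    case False
    have "diff_h h j (v k) x = diff_h h j (w k) x"
      by (rule diff_h_cong[OF _ assms(2)])
        (simp add: assms(1) staggered_curl_steps(2)[OF False] grid_offset_unit)
    then show ?thesis by simp
  qed simp
qed

lemma edge_fn_curl_h:
  assumes "face_fn L h f"
  shows "edge_fn L h (curl_h h f)"
  unfolding edge_fn_def
proof
  fix i
  have "periodic_on L (grid h (edge_offset i)) (\<lambda>x. levi_civita i j k * diff_h h j (f k) x)" for j k
  proof (cases "levi_civita i j k = 0")
    case False
    have "periodic_on L (grid h (edge_offset i)) (diff_h h j (f k))"
      using assms by (intro periodic_on_diff_h) (simp add: staggered_curl_steps(1)[OF False] face_fn_def)
    then show ?thesis
      by (intro periodic_on_mult periodic_on_const)
  qed (simp add: periodic_on_const)
  then show "periodic_on L (grid h (edge_offset i)) (curl_h h f i)"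
    unfolding curl_h_def by (intro periodic_on_sum)
qed

lemma edge_fn_grad_h:
  assumes "node_fn L h \<psi>"
  shows "edge_fn L h (grad_h h \<psi>)"
  using assms unfolding edge_fn_def grad_h_def
  by (auto intro!: periodic_on_diff_h simp: staggered_half_steps grid_offset_unit node_fn_def)

lemma node_fn_div_h:
  assumes "edge_fn L h a"
  shows "node_fn L h (div_h h a)"
  using assms unfolding node_fn_def div_h_def
  by (intro periodic_on_sum periodic_on_diff_h) (simp add: staggered_half_steps edge_fn_def)

text \<open>The weight \<open>h\<^sup>3\<close> is left out; it is a common positive factor that cancels wherever orthogonality
  is concerned.\<close>

definition vector_inner :: "nat \<Rightarrow> real \<Rightarrow> (3 \<Rightarrow> real^3) \<Rightarrow> vector_fn \<Rightarrow> vector_fn \<Rightarrow> real" where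
  "vector_inner N h s u v = (\<Sum>i\<in>UNIV. period_sum N h (s i) (\<lambda>x. u i x * v i x))"

lemma period_sum_sum:
  "period_sum N h s (\<lambda>x. \<Sum>b\<in>B. u b x) = (\<Sum>b\<in>B. period_sum N h s (u b))"
  unfolding period_sum_def by (rule sum.swap)

lemma period_sum_cmult: "period_sum N h s (\<lambda>x. c * u x) = c * period_sum N h s u"
  by (simp add: period_sum_def sum_distrib_left)

lemma vector_inner_diff:
  "vector_inner N h s u (\<lambda>i x. v i x - w i x) = vector_inner N h s u v - vector_inner N h s u w"
  by (simp add: vector_inner_def period_sum_def sum_subtractf algebra_simps)

context periodic_grid
begin

lemma period_sum_square_zero:
  assumes "periodic_on L (grid h s) u" "period_sum N h s (\<lambda>x. u x * u x) = 0" "x \<in> grid h s"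
  shows "u x = 0"
proof (rule periodic_zero_on_period[OF assms(1) _ assms(3)])
  have "\<forall>x\<in>grid_period N h s. u x * u x = 0"
    using assms(2) unfolding period_sum_def by (subst (asm) sum_nonneg_eq_0_iff) auto
  then show "u x = 0" if "x \<in> grid_period N h s" for x
    using that by simp
qed

text \<open>Exchanging the outer indices of \<open>\<epsilon>\<^sub>i\<^sub>j\<^sub>k\<close> costs a sign, which cancels the sign of summation by
  parts. Only the terms with \<open>\<epsilon>\<^sub>i\<^sub>j\<^sub>k \<noteq> 0\<close> live on matching grids.\<close>

lemma curl_adjoint:
  assumes a: "edge_fn L h a" and f: "face_fn L h f"
  shows "vector_inner N h face_offset (curl_h h a) f = vector_inner N h edge_offset a (curl_h h f)"
proof -
  have "levi_civita i j k * period_sum N h (face_offset i) (\<lambda>x. f i x * diff_h h j (a k) x)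
      = levi_civita k j i * period_sum N h (edge_offset k) (\<lambda>x. a k x * diff_h h j (f i) x)" for i j k
  proof (cases "levi_civita i j k = 0")
    case False
    then have step: "face_offset i + (1 / 2) *\<^sub>R unit_vec j = edge_offset k + unit_vec j"
      and "levi_civita k j i \<noteq> 0"
      by (simp_all add: staggered_curl_steps(2) levi_civita_swap[of k j i])
    then have back_step: "edge_offset k + (1 / 2) *\<^sub>R unit_vec j = face_offset i"
      by (simp add: staggered_curl_steps(1))
    have per: "periodic_on L (grid h (edge_offset k)) (a k)" "periodic_on L (grid h (face_offset i)) (f i)"
      using a f by (simp_all add: edge_fn_def face_fn_def)
    have per': "periodic_on L (grid h (edge_offset k)) (diff_h h j (f i))"
      by (rule periodic_on_diff_h) (simp only: back_step per)
    have "period_sum N h (face_offset i) (\<lambda>x. f i x * diff_h h j (a k) x)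
        = - period_sum N h (edge_offset k + unit_vec j) (\<lambda>x. diff_h h j (f i) x * a k x)"
      using sum_by_parts[of "face_offset i" "f i" j "a k"] per
      by (simp add: step grid_offset_unit)
    also have "\<dots> = - period_sum N h (edge_offset k) (\<lambda>x. diff_h h j (f i) x * a k x)"
      by (simp add: period_sum_offset_unit periodic_on_mult per per')
    finally show ?thesis
      by (simp add: levi_civita_swap[of k j i] mult.commute)
  qed (simp add: levi_civita_swap[of k j i])
  then have "(\<Sum>i\<in>UNIV. \<Sum>j\<in>UNIV. \<Sum>k\<in>UNIV.
        levi_civita i j k * period_sum N h (face_offset i) (\<lambda>x. f i x * diff_h h j (a k) x))
      = (\<Sum>k\<in>UNIV. \<Sum>j\<in>UNIV. \<Sum>i\<in>UNIV.
        levi_civita k j i * period_sum N h (edge_offset k) (\<lambda>x. a k x * diff_h h j (f i) x))"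
    by (simp add: sum_3)
  moreover have "curl_h h a i x * f i x
      = (\<Sum>j\<in>UNIV. \<Sum>k\<in>UNIV. levi_civita i j k * (f i x * diff_h h j (a k) x))" for i x
    unfolding curl_h_def sum_distrib_right by (intro sum.cong refl) simp
  moreover have "a k x * curl_h h f k x
      = (\<Sum>j\<in>UNIV. \<Sum>i\<in>UNIV. levi_civita k j i * (a k x * diff_h h j (f i) x))" for k x
    unfolding curl_h_def sum_distrib_left by (intro sum.cong refl) simp
  ultimately show ?thesis
    by (simp only: vector_inner_def period_sum_sum period_sum_cmult)
qed

lemma grad_div_adjoint:
  assumes a: "edge_fn L h a" and \<psi>: "node_fn L h \<psi>"
  shows "vector_inner N h edge_offset a (grad_h h \<psi>)
       = - period_sum N h node_offset (\<lambda>x. div_h h a x * \<psi> x)"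
proof -
  have per: "periodic_on L (grid h (edge_offset i)) (a i)" for i
    using a by (simp add: edge_fn_def)
  have per_\<psi>: "periodic_on L (grid h node_offset) \<psi>"
    using \<psi> by (simp add: node_fn_def)
  have per': "periodic_on L (grid h node_offset) (diff_h h i (a i))" for i
    by (rule periodic_on_diff_h) (simp only: staggered_half_steps per)
  have "period_sum N h (edge_offset i) (\<lambda>x. a i x * diff_h h i \<psi> x)
      = - period_sum N h node_offset (\<lambda>x. diff_h h i (a i) x * \<psi> x)" for i
    using sum_by_parts[of "edge_offset i" "a i" i \<psi>] per[of i] per'[of i] per_\<psi>
    by (simp add: staggered_half_steps grid_offset_unit period_sum_offset_unit periodic_on_mult)
  then show ?thesis
    by (simp add: vector_inner_def grad_h_def div_h_def sum_distrib_right period_sum_sum sum_negf)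
qed

section \<open>The discrete Hodge decomposition\<close>

text \<open>The \<open>N\<close>-periodic indicator function of the node with index \<open>k\<close>, meant for \<open>k\<close> in the index box.
  The gradients of these functions span all gradients of node functions.\<close>

definition node_bump :: "int^3 \<Rightarrow> scalar_fn" where
  "node_bump k y = of_bool (\<exists>n. y = grid_point h node_offset n \<and> wrap N n = k)"

lemma node_bump_grid_point: "node_bump k (grid_point h node_offset n) = of_bool (wrap N n = k)"
  by (auto simp: node_bump_def grid_point_inj)

lemma node_fn_bump: "node_fn L h (node_bump k)"
  unfolding node_fn_def periodic_on_def
proof (intro ballI allI)
  fix y \<alpha> assume "y \<in> grid h node_offset"
  then obtain n where n: "y = grid_point h node_offset n"
    by (auto simp: grid_def)
  have "y + L *\<^sub>R unit_vec \<alpha> = grid_point h node_offset (n + of_nat N * axis \<alpha> 1)"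
    by (simp add: n grid_point_def L_eq vec_eq_iff axis_def of_nat_index algebra_simps)
  moreover have "wrap N (n + of_nat N * axis \<alpha> 1) = wrap N n"
    by (simp add: vec_eq_iff of_nat_index)
  ultimately show "node_bump k (y + L *\<^sub>R unit_vec \<alpha>) = node_bump k y"
    by (simp only: n node_bump_grid_point)
qed

lemma period_sum_bump:
  assumes "k \<in> index_box N"
  shows "period_sum N h node_offset (\<lambda>x. u x * node_bump k x) = u (grid_point h node_offset k)"
proof -
  have "period_sum N h node_offset (\<lambda>x. u x * node_bump k x)
      = (\<Sum>n\<in>index_box N. if n = k then u (grid_point h node_offset n) else 0)"
    unfolding period_sum_index node_bump_grid_point
    by (intro sum.cong refl) (auto simp: vec_eq_iff)
  then show ?thesis
    using assms finite_index_box by (simp add: sum.delta)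
qed

text \<open>Testing the residual against the gradient of a bump at a node reads off its divergence there; this is
  why projecting onto finitely many gradients already makes the residual divergence-free.\<close>

lemma hodge_gradient:
  assumes w: "edge_fn L h w"
    and orth: "\<And>a. edge_fn L h a \<Longrightarrow> (\<forall>x\<in>grid h node_offset. div_h h a x = 0)
        \<Longrightarrow> vector_inner N h edge_offset a w = 0"
  shows "\<exists>\<psi>. node_fn L h \<psi> \<and> (\<forall>i. \<forall>x\<in>grid h (edge_offset i). w i x = grad_h h \<psi> i x)"
proof -
  let ?S = "SIGMA i:UNIV. grid_period N h (edge_offset i)"
  obtain c where c: "\<And>b. b \<in> index_box N \<Longrightarrow>
      (\<Sum>p\<in>?S. (w (fst p) (snd p) - (\<Sum>b'\<in>index_box N. c b' * grad_h h (node_bump b') (fst p) (snd p)))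
          * grad_h h (node_bump b) (fst p) (snd p)) = 0"
    using finite_projection[of "index_box N" ?S "\<lambda>p. w (fst p) (snd p)"
        "\<lambda>b p. grad_h h (node_bump b) (fst p) (snd p)"] finite_index_box by auto
  define \<psi> where "\<psi> = (\<lambda>y. \<Sum>b\<in>index_box N. c b * node_bump b y)"
  define r where "r = (\<lambda>i x. w i x - grad_h h \<psi> i x)"
  have \<psi>: "node_fn L h \<psi>"
    unfolding node_fn_def \<psi>_def
    by (intro periodic_on_sum periodic_on_mult periodic_on_const node_fn_bump[unfolded node_fn_def])
  have r: "edge_fn L h r"
    using w edge_fn_grad_h[OF \<psi>] by (simp add: edge_fn_def r_def periodic_on_diff)
  have r_orth: "vector_inner N h edge_offset r (grad_h h (node_bump b)) = 0" if "b \<in> index_box N" for b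
  proof -
    have "vector_inner N h edge_offset r (grad_h h (node_bump b))
        = (\<Sum>p\<in>?S. r (fst p) (snd p) * grad_h h (node_bump b) (fst p) (snd p))"
      unfolding vector_inner_def period_sum_def by (subst sum.Sigma) (simp_all add: case_prod_beta)
    moreover have "grad_h h \<psi> i x = (\<Sum>b'\<in>index_box N. c b' * grad_h h (node_bump b') i x)" for i x
      unfolding \<psi>_def grad_h_def by (rule diff_h_sum)
    ultimately show ?thesis
      unfolding r_def using c[OF that] by simp
  qed
  have div_period: "div_h h r x = 0" if x: "x \<in> grid_period N h node_offset" for x
  proof -
    obtain k where x_eq: "x = grid_point h node_offset k" and k: "k \<in> index_box N"
      using x unfolding grid_period_def by (rule imageE)
    have "div_h h r x = period_sum N h node_offset (\<lambda>y. div_h h r y * node_bump k y)"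
      unfolding x_eq by (rule period_sum_bump[OF k, symmetric])
    also have "\<dots> = - vector_inner N h edge_offset r (grad_h h (node_bump k))"
      by (simp only: grad_div_adjoint[OF r node_fn_bump] minus_minus)
    also have "\<dots> = 0"
      by (simp only: r_orth[OF k] minus_zero)
    finally show ?thesis .
  qed
  have div: "\<forall>x\<in>grid h node_offset. div_h h r x = 0"
    using periodic_zero_on_period[OF node_fn_div_h[OF r, unfolded node_fn_def]] div_period by blast
  then have "\<forall>x\<in>grid_period N h node_offset. div_h h r x * \<psi> x = 0"
    using div_period by simp
  then have "vector_inner N h edge_offset r (grad_h h \<psi>) = 0"
    by (simp only: grad_div_adjoint[OF r \<psi>] period_sum_def sum.neutral minus_zero)
  then have "vector_inner N h edge_offset r (\<lambda>i x. w i x - grad_h h \<psi> i x) = 0"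
    using orth[OF r div] by (simp add: vector_inner_diff)
  then have "vector_inner N h edge_offset r r = 0"
    by (simp add: r_def)
  then have "\<forall>i\<in>UNIV. period_sum N h (edge_offset i) (\<lambda>x. r i x * r i x) = 0"
    unfolding vector_inner_def
    by (subst (asm) sum_nonneg_eq_0_iff) (auto simp: period_sum_def intro: sum_nonneg)
  then have "r i x = 0" if "x \<in> grid h (edge_offset i)" for i x
    using period_sum_square_zero[OF _ _ that, of "r i"] r by (auto simp: edge_fn_def)
  then show ?thesis
    using \<psi> by (intro exI[of _ \<psi>]) (simp add: r_def)
qed

section \<open>Uniqueness for the Poisson equation\<close>

text \<open>Discrete energy argument: \<open>\<Sum>\<^sub>\<alpha> \<langle>D\<^sub>\<alpha> u, D\<^sub>\<alpha> u\<rangle> = - \<langle>u, L u\<rangle> = 0\<close>.\<close>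

lemma harmonic_mean_zero:
  assumes u: "periodic_on L (grid h s) u"
    and harmonic: "\<And>x. x \<in> grid h s \<Longrightarrow> laplace_h h u x = 0"
    and mean: "period_sum N h s u = 0"
    and x: "x \<in> grid h s"
  shows "u x = 0"
proof -
  let ?t = "\<lambda>\<alpha>. s + (1 / 2) *\<^sub>R unit_vec \<alpha>"
  have per: "periodic_on L (grid h (?t \<alpha>)) (diff_h h \<alpha> u)" for \<alpha>
  proof (rule periodic_on_diff_h)
    have "?t \<alpha> + (1 / 2) *\<^sub>R unit_vec \<alpha> = s + unit_vec \<alpha>"
      by (simp add: add.assoc flip: scaleR_add_left)
    then show "periodic_on L (grid h (?t \<alpha> + (1 / 2) *\<^sub>R unit_vec \<alpha>)) u"
      by (simp only: grid_offset_unit u)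
  qed
  have "(\<Sum>\<alpha>\<in>UNIV. period_sum N h (?t \<alpha>) (\<lambda>x. diff_h h \<alpha> u x * diff_h h \<alpha> u x))
      = - (\<Sum>\<alpha>\<in>UNIV. period_sum N h s (\<lambda>x. u x * diff_h h \<alpha> (diff_h h \<alpha> u) x))"
    by (simp add: sum_by_parts[OF u per] sum_negf)
  also have "\<dots> = - period_sum N h s (\<lambda>x. u x * laplace_h h u x)"
    using h_pos by (simp add: laplace_h_diff_h sum_distrib_left period_sum_sum)
  also have "\<dots> = 0"
    using harmonic grid_period_subset unfolding period_sum_def
    by (simp add: subset_iff)
  finally have "\<forall>\<alpha>\<in>UNIV. period_sum N h (?t \<alpha>) (\<lambda>x. diff_h h \<alpha> u x * diff_h h \<alpha> u x) = 0"
    by (subst (asm) sum_nonneg_eq_0_iff) (auto simp: period_sum_def intro: sum_nonneg)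
  then have flat: "diff_h h \<alpha> u y = 0" if "y \<in> grid h (?t \<alpha>)" for \<alpha> y
    using period_sum_square_zero[OF per _ that] by simp
  have "u (y + h *\<^sub>R unit_vec \<alpha>) = u y" if "y \<in> grid h s" for y \<alpha>
  proof -
    let ?k = "(h / 2) *\<^sub>R unit_vec \<alpha>"
    have "y + h *\<^sub>R unit_vec \<alpha> = y + ?k + ?k"
      by (simp add: add.assoc flip: scaleR_add_left)
    moreover have "u (y + ?k + ?k) = u (y + ?k - ?k)"
      using flat[OF grid_half_step(1)[OF that, of \<alpha>]] h_pos by (simp only: diff_h_def) simp
    ultimately show ?thesis by (simp only: add_diff_cancel)
  qed
  \<comment> \<open>invariance under a single step is periodicity with \<open>K = 1\<close>, which links all points of the grid\<close>
  then have "periodic_on (real 1 * h) (grid h s) u"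
    by (simp add: periodic_on_def)
  from periodic_on_int_translate[OF this, of 0] have const: "u (grid_point h s n) = u (grid_point h s 0)" for n
    by simp
  have "period_sum N h s u = real (card (index_box N)) * u (grid_point h s 0)"
    unfolding period_sum_index by (subst const) simp
  moreover have "card (index_box N) \<noteq> 0"
    using finite_index_box wrap_in_box[of 0] card_0_eq by blast
  ultimately have "u (grid_point h s 0) = 0"
    using mean by simp
  then show ?thesis
    using x const by (auto simp: grid_def)
qed

end

section \<open>Spreading, interpolation and power\<close>

text \<open>The translation is absorbed by reindexing the lattice sum, an unordered sum being invariant
  under bijections.\<close>

lemma delta_h_periodic: "delta_h \<phi> L h (x + L *\<^sub>R unit_vec \<alpha>) = delta_h \<phi> L h x"
proof -
  have "bij (\<lambda>n. n + axis \<alpha> 1 :: int^3)"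
    by (rule bij_betw_byWitness[where f' = "\<lambda>n. n - axis \<alpha> 1"]) auto
  then have "infsum (\<lambda>n. delta_free \<phi> h (x + L *\<^sub>R int_vec (n + axis \<alpha> 1))) UNIV
      = infsum (\<lambda>n. delta_free \<phi> h (x + L *\<^sub>R int_vec n)) UNIV"
    by (rule infsum_reindex_bij_betw)
  then show ?thesis
    unfolding delta_h_def int_vec_add int_vec_axis by (simp add: algebra_simps)
qed

text \<open>The set of gradients at \<open>x + c\<close> and at \<open>x\<close> is the same, so the definite descriptions agree.\<close>

lemma gradient_periodic:
  assumes "\<And>y. g (y + c) = g y"
  shows "gradient g (x + c) = gradient g x"
proof -
  have shift: "GDERIV g y :> D" if D: "GDERIV g (y + d) :> D" and per: "\<And>y. g (y + d) = g y" for d y D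
  proof -
    have "((\<lambda>y. y + d) has_derivative (\<lambda>v. v)) (at y)"
      by (auto intro!: derivative_eq_intros)
    from has_derivative_compose[OF this D[unfolded gderiv_def]]
    show ?thesis
      unfolding gderiv_def per .
  qed
  have back_step: "g (y + - c) = g y" for y
    using assms[of "y - c"] by simp
  have "GDERIV g (x + c) :> D \<longleftrightarrow> GDERIV g x :> D" for D
  proof
    assume "GDERIV g x :> D"
    then show "GDERIV g (x + c) :> D"
      using shift[of "x + c" "- c" D, OF _ back_step] by simp
  qed (rule shift[OF _ assms])
  then show ?thesis
    by (simp add: gradient_def)
qed

lemma edge_fn_spread_curl:
  assumes "\<And>x \<alpha>. \<delta> (x + L *\<^sub>R unit_vec \<alpha>) = \<delta> x"
  shows "edge_fn L h (spread_curl \<delta> M X F \<Delta>s)"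
proof -
  have "gradient \<delta> (x + L *\<^sub>R unit_vec \<alpha> - Y) = gradient \<delta> (x - Y)" for x \<alpha> Y
    using gradient_periodic[of \<delta> "L *\<^sub>R unit_vec \<alpha>" "x - Y"] assms by (simp add: algebra_simps)
  then show ?thesis
    by (simp add: edge_fn_def periodic_on_def spread_curl_def)
qed

text \<open>The cyclic symmetry of \<open>\<epsilon>\<close> moves the force into the cross product:
  \<open>(a \<times> \<nabla>\<delta>) \<bullet> b = a \<bullet> (\<nabla>\<delta> \<times> b)\<close>. The vector identity does not apply as it stands, because the
  components of \<open>a\<close> are sampled on different grids; the weighted moments \<open>G j k\<close> take its place.\<close>

lemma marker_power:
  "(marker_velocity N h \<delta> u0 a Y \<bullet> b) * c
     = u0 \<bullet> (c *\<^sub>R b) + h ^ 3 * vector_inner N h edge_offset a (\<lambda>j x. cross3 (gradient \<delta> (x - Y)) (c *\<^sub>R b) $ j)"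
proof -
  define G where "G j k = (\<Sum>x\<in>grid_period N h (edge_offset j). a j x * gradient \<delta> (x - Y) $ k * h ^ 3)" for j k
  have "h ^ 3 * period_sum N h (edge_offset j) (\<lambda>x. a j x * cross3 (gradient \<delta> (x - Y)) (c *\<^sub>R b) $ j)
      = (\<Sum>k\<in>UNIV. \<Sum>i\<in>UNIV. levi_civita j k i * G j k * (c * b $ i))" for j
  proof -
    have "h ^ 3 * (a j x * cross3 (gradient \<delta> (x - Y)) (c *\<^sub>R b) $ j)
        = (\<Sum>k\<in>UNIV. \<Sum>i\<in>UNIV. levi_civita j k i * (a j x * gradient \<delta> (x - Y) $ k * h ^ 3) * (c * b $ i))" for x
      unfolding cross3_levi_civita vector_scaleR_component real_scaleR_def sum_distrib_left
      by (intro sum.cong refl) simp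
    then have "h ^ 3 * period_sum N h (edge_offset j) (\<lambda>x. a j x * cross3 (gradient \<delta> (x - Y)) (c *\<^sub>R b) $ j)
       = period_sum N h (edge_offset j) (\<lambda>x. \<Sum>k\<in>UNIV. \<Sum>i\<in>UNIV.
            levi_civita j k i * (a j x * gradient \<delta> (x - Y) $ k * h ^ 3) * (c * b $ i))"
      by (simp only: period_sum_cmult[symmetric])
    also have "\<dots> = (\<Sum>k\<in>UNIV. \<Sum>i\<in>UNIV. levi_civita j k i * G j k * (c * b $ i))"
      unfolding period_sum_sum
      by (simp only: period_sum_def G_def sum_distrib_left sum_distrib_right)
    finally show ?thesis .
  qed
  moreover have "(marker_velocity N h \<delta> u0 a Y \<bullet> b) * c = u0 \<bullet> (c *\<^sub>R b)
      + (\<Sum>j\<in>UNIV. \<Sum>k\<in>UNIV. \<Sum>i\<in>UNIV. levi_civita j k i * G j k * (c * b $ i))"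
    unfolding marker_velocity_def G_def[symmetric] inner_vec_def sum_3
    by (simp add: levi_civita_def) algebra
  ultimately show ?thesis
    by (simp only: vector_inner_def sum_distrib_left)
qed

lemma total_marker_power:
  "(\<Sum>m = 1..M. (marker_velocity N h \<delta> u0 a (X m) \<bullet> F m) * \<Delta>s)
     = u0 \<bullet> (\<Sum>m = 1..M. \<Delta>s *\<^sub>R F m)
       + h ^ 3 * vector_inner N h edge_offset a (spread_curl \<delta> M X F \<Delta>s)"
proof -
  have "vector_inner N h edge_offset a (spread_curl \<delta> M X F \<Delta>s)
      = (\<Sum>m = 1..M. vector_inner N h edge_offset a
          (\<lambda>j x. cross3 (gradient \<delta> (x - X m)) (\<Delta>s *\<^sub>R F m) $ j))"
    unfolding vector_inner_def spread_curl_def sum_component sum_distrib_left period_sum_sum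
    by (rule sum.swap)
  then show ?thesis
    by (simp only: marker_power sum.distrib inner_sum_right sum_distrib_left)
qed

lemma face_inner_velocity_field:
  assumes "L \<noteq> 0"
  shows "face_inner N h (velocity_field h u0 a) f
     = u0 \<bullet> (L ^ 3 *\<^sub>R face_mean L N h f) + h ^ 3 * vector_inner N h face_offset (curl_h h a) f"
  using assms
  by (simp add: face_inner_def velocity_field_def face_mean_def vector_inner_def period_sum_def
      inner_vec_def sum_3 sum.distrib sum_distrib_left algebra_simps)

context periodic_grid
begin

lemma power_identity_iff:
  assumes a: "edge_fn L h a" and f: "face_fn L h f"
  shows "power_identity N h \<delta> M X F \<Delta>s f u0 a \<longleftrightarrow>
      u0 \<bullet> (L ^ 3 *\<^sub>R face_mean L N h f - (\<Sum>m = 1..M. \<Delta>s *\<^sub>R F m))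
      + h ^ 3 * vector_inner N h edge_offset a (\<lambda>i x. curl_h h f i x - spread_curl \<delta> M X F \<Delta>s i x) = 0"
proof -
  have "L \<noteq> 0"
    using L_eq N_pos h_pos by simp
  show ?thesis
    unfolding power_identity_def face_inner_velocity_field[OF \<open>L \<noteq> 0\<close>] total_marker_power
      curl_adjoint[OF a f] vector_inner_diff inner_diff_right
    by (auto simp: algebra_simps)
qed

lemma mean_condition_iff:
  "mean_condition L N h M F \<Delta>s f \<longleftrightarrow> L ^ 3 *\<^sub>R face_mean L N h f - (\<Sum>m = 1..M. \<Delta>s *\<^sub>R F m) = 0"
proof -
  have "L ^ 3 \<noteq> 0"
    using L_eq N_pos h_pos by simp
  then have "a = (1 / L ^ 3) *\<^sub>R b \<longleftrightarrow> L ^ 3 *\<^sub>R a - b = 0" for a b :: "real^3"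
    by (auto simp: vec_eq_iff field_simps)
  then show ?thesis
    unfolding mean_condition_def .
qed

lemma power_identity_characterisation:
  assumes \<delta>: "\<And>x \<alpha>. \<delta> (x + L *\<^sub>R unit_vec \<alpha>) = \<delta> x" and f: "face_fn L h f"
  shows "(\<forall>u0 a. edge_fn L h a \<and> (\<forall>x\<in>grid h node_offset. div_h h a x = 0)
        \<longrightarrow> power_identity N h \<delta> M X F \<Delta>s f u0 a)
      \<longleftrightarrow> mean_condition L N h M F \<Delta>s f \<and> curl_condition L h \<delta> M X F \<Delta>s f"
    (is "?P \<longleftrightarrow> ?mean \<and> ?curl")
proof -
  let ?b = "L ^ 3 *\<^sub>R face_mean L N h f - (\<Sum>m = 1..M. \<Delta>s *\<^sub>R F m)"
  let ?w = "\<lambda>i x. curl_h h f i x - spread_curl \<delta> M X F \<Delta>s i x"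
  have w: "edge_fn L h ?w"
    using edge_fn_curl_h[OF f] edge_fn_spread_curl[OF \<delta>]
    by (simp add: edge_fn_def periodic_on_diff)
  show ?thesis
  proof
    assume P: ?P
    have zero: "edge_fn L h (\<lambda>_ _. 0)" "div_h h (\<lambda>_ _. 0) x = 0" for x
      by (simp_all add: edge_fn_def periodic_on_const div_h_def diff_h_def)
    \<comment> \<open>testing with the defect of the mean condition itself as \<open>u\<^sub>0\<close>\<close>
    have "power_identity N h \<delta> M X F \<Delta>s f ?b (\<lambda>_ _. 0)"
      using P zero by blast
    then have "?b \<bullet> ?b = 0"
      using power_identity_iff[OF zero(1) f] by (simp add: vector_inner_def period_sum_def)
    then have mean: ?mean
      unfolding mean_condition_iff by (simp only: inner_eq_zero_iff)
    have "vector_inner N h edge_offset a ?w = 0"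
      if "edge_fn L h a" "\<forall>x\<in>grid h node_offset. div_h h a x = 0" for a
    proof -
      have "power_identity N h \<delta> M X F \<Delta>s f 0 a"
        using P that by blast
      then show ?thesis
        using power_identity_iff[OF that(1) f] h_pos by simp
    qed
    from hodge_gradient[OF w this] obtain \<psi> where "node_fn L h \<psi>"
      "\<forall>i. \<forall>x\<in>grid h (edge_offset i). ?w i x = grad_h h \<psi> i x"
      by blast
    then have ?curl
      unfolding curl_condition_def by (intro exI[of _ \<psi>]) (simp add: algebra_simps)
    with mean show "?mean \<and> ?curl" ..
  next
    assume "?mean \<and> ?curl"
    then obtain \<psi> where b: "?b = 0" and \<psi>: "node_fn L h \<psi>"
      and curl: "\<And>i x. x \<in> grid h (edge_offset i) \<Longrightarrow> ?w i x = grad_h h \<psi> i x"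
      unfolding mean_condition_iff curl_condition_def by auto
    show ?P
    proof (intro allI impI)
      fix u0 a assume a: "edge_fn L h a \<and> (\<forall>x\<in>grid h node_offset. div_h h a x = 0)"
      have "vector_inner N h edge_offset a ?w = vector_inner N h edge_offset a (grad_h h \<psi>)"
        unfolding vector_inner_def period_sum_def
        by (intro sum.cong refl) (simp add: curl subsetD[OF grid_period_subset])
      also have "\<dots> = - period_sum N h node_offset (\<lambda>x. div_h h a x * \<psi> x)"
        using a \<psi> by (simp add: grad_div_adjoint)
      also have "\<dots> = 0"
        using a grid_period_subset[of N h node_offset] by (auto simp: period_sum_def intro!: sum.neutral)
      finally show "power_identity N h \<delta> M X F \<Delta>s f u0 a"
        using power_identity_iff[of a f] a f b by simp
    qed
  qed
qed

text \<open>The face with offset \<open>face_offset i\<close> lies half a step in direction \<open>i\<close> from cell centres, so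
  vanishing divergence on the cell grid makes its gradient vanish on the face grids.\<close>

lemma curl_condition_poisson:
  assumes curl: "curl_condition L h \<delta> M X F \<Delta>s f"
    and div: "\<And>x. x \<in> grid h cell_offset \<Longrightarrow> div_h h f x = 0"
  shows "vector_poisson h \<delta> M X F \<Delta>s f"
  unfolding vector_poisson_def
proof (intro allI ballI)
  fix i x assume x: "x \<in> grid h (face_offset i)"
  obtain \<psi> where \<psi>: "\<And>i x. x \<in> grid h (edge_offset i) \<Longrightarrow>
      curl_h h f i x = spread_curl \<delta> M X F \<Delta>s i x + grad_h h \<psi> i x"
    using curl unfolding curl_condition_def by blast
  have "face_offset i + (1 / 2) *\<^sub>R unit_vec i = cell_offset"
    by (simp add: face_offset_def)
  then have "diff_h h i (div_h h f) x = diff_h h i (\<lambda>_. 0) x"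
    by (intro diff_h_cong[OF _ x]) (simp add: div)
  then have "- vec_laplace_h h f i x = curl_h h (curl_h h f) i x"
    using h_pos by (simp add: curl_h_curl_h grad_h_def diff_h_def)
  also have "\<dots> = curl_h h (\<lambda>i x. spread_curl \<delta> M X F \<Delta>s i x + grad_h h \<psi> i x) i x"
    by (rule curl_h_cong[OF \<psi> x])
  also have "\<dots> = curl_h h (spread_curl \<delta> M X F \<Delta>s) i x"
    by (simp add: curl_h_add curl_h_grad_h)
  finally show "- vec_laplace_h h f i x = curl_h h (spread_curl \<delta> M X F \<Delta>s) i x" .
qed

lemma vector_poisson_unique:
  assumes f: "face_fn L h f" "vector_poisson h \<delta> M X F \<Delta>s f"
    and g: "face_fn L h g" "vector_poisson h \<delta> M X F \<Delta>s g"
    and mean: "face_mean L N h g = face_mean L N h f"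
    and x: "x \<in> grid h (face_offset i)"
  shows "g i x = f i x"
proof -
  let ?d = "\<lambda>x. g i x - f i x"
  have "?d x = 0"
  proof (rule harmonic_mean_zero[OF _ _ _ x])
    show "periodic_on L (grid h (face_offset i)) ?d"
      using f(1) g(1) by (simp add: face_fn_def periodic_on_diff)
    show "laplace_h h ?d y = 0" if "y \<in> grid h (face_offset i)" for y
    proof -
      have "laplace_h h ?d y = laplace_h h (g i) y - laplace_h h (f i) y"
        unfolding laplace_h_def sum_subtractf[symmetric]
        by (intro sum.cong refl) (simp add: diff_divide_distrib add_divide_distrib algebra_simps)
      moreover have "laplace_h h (g i) y = laplace_h h (f i) y"
        using f(2) g(2) that unfolding vector_poisson_def vec_laplace_h_def
        by (metis neg_equal_iff_equal)
      ultimately show ?thesis by simp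
    qed
    have "face_mean L N h g $ i = face_mean L N h f $ i"
      by (simp add: mean)
    moreover have "L \<noteq> 0"
      using L_eq N_pos h_pos by simp
    ultimately show "period_sum N h (face_offset i) ?d = 0"
      using h_pos by (simp add: face_mean_def period_sum_def sum_subtractf flip: sum_distrib_right)
  qed
  then show ?thesis by simp
qed

end

theorem mainTheorem2:
  fixes L h \<Delta>s :: real and N M :: nat
    and \<phi> :: "real \<Rightarrow> real" and \<delta> :: "real^3 \<Rightarrow> real"
    and X F :: "nat \<Rightarrow> real^3" and f :: vector_fn
  assumes "L > 0" and "N > 0" and "h = L / real N" and "\<Delta>s > 0"
    and "compactly_supported \<phi>" and "\<delta> = delta_h \<phi> L h" and "C1_fn \<delta>"
    and "\<And>m. m \<in> {1..M} \<Longrightarrow> X m \<in> cbox 0 (\<chi> i. L)"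
    and "face_fn L h f"
  shows
    "((\<forall>u0 a. edge_fn L h a \<and> (\<forall>x\<in>grid h node_offset. div_h h a x = 0)
        \<longrightarrow> power_identity N h \<delta> M X F \<Delta>s f u0 a)
      \<longleftrightarrow> mean_condition L N h M F \<Delta>s f \<and> curl_condition L h \<delta> M X F \<Delta>s f)
    \<and>
     (mean_condition L N h M F \<Delta>s f \<and> curl_condition L h \<delta> M X F \<Delta>s f
        \<and> (\<forall>x\<in>grid h cell_offset. div_h h f x = 0)
      \<longrightarrow> vector_poisson h \<delta> M X F \<Delta>s f
        \<and> (\<forall>g. face_fn L h g \<and> vector_poisson h \<delta> M X F \<Delta>s g
              \<and> face_mean L N h g = face_mean L N h f
            \<longrightarrow> (\<forall>i. \<forall>x\<in>grid h (face_offset i). g i x = f i x)))"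
proof -
  interpret periodic_grid L h N
    using assms(1-3) by unfold_locales auto
  have \<delta>: "\<delta> (x + L *\<^sub>R unit_vec \<alpha>) = \<delta> x" for x \<alpha>
    by (simp only: assms(6) delta_h_periodic)
  have poisson: "vector_poisson h \<delta> M X F \<Delta>s f"
    if "curl_condition L h \<delta> M X F \<Delta>s f" "\<forall>x\<in>grid h cell_offset. div_h h f x = 0"
    using curl_condition_poisson that by blast
  show ?thesis
    using power_identity_characterisation[OF \<delta> assms(9)] poisson
      vector_poisson_unique[OF assms(9)] by blast
qed

end
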